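(* Let $\Gamma=(G,\sigma)$ be a connected signed graph of order $n$ containing at least one cycle, with girth $g$. Then $\eta(\Gamma)\le n-g+2$. Equality holds if and only if $\Gamma$ is a balanced cycle $C_g^\sigma$ with $g\equiv 0\pmod 4$, or an unbalanced cycle $C_g^\sigma$ with $g\equiv 2\pmod 4$, or $\Gamma$ is switching equivalent to $(K_{n_1,n_2},+)$.
   Context: A signed graph $\Gamma=(G,\sigma)$ is a simple graph $G$ with a sign function $\sigma:E(G)\to\{+,-\}$; $(G,+)$ denotes all edges positive. Its adjacency matrix has $(u,v)$-entry $\sigma(uv)$ if $uv\in E(G)$, $0$ otherwise; $\eta(\Gamma)$ (the nullity) is the multiplicity of $0$ as an eigenvalue. A cycle is balanced if the product of its edge signs is $+$, unbalanced otherwise. Switching by $\theta:V\to\{+,-\}$ replaces $\sigma(xy)$ by $\theta(x)\sigma(xy)\theta(y)$; switching equivalent signed graphs are related by a switching. The girth is the length of a shortest cycle. $K_{n_1,n_2}$ is the complete bipartite graph with parts of sizes $n_1,n_2$. *)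

theory Defs
  imports "Jordan_Normal_Form.Char_Poly"
begin

definition signed_graph :: "'a set \<Rightarrow> ('a \<Rightarrow> 'a \<Rightarrow> bool) \<Rightarrow> ('a \<Rightarrow> 'a \<Rightarrow> real) \<Rightarrow> bool" where
  "signed_graph V E sig \<longleftrightarrow> finite V
     \<and> (\<forall>u v. E u v \<longrightarrow> u \<in> V \<and> v \<in> V)
     \<and> (\<forall>u v. E u v \<longrightarrow> E v u)
     \<and> (\<forall>u. \<not> E u u)
     \<and> (\<forall>u v. E u v \<longrightarrow> sig u v = sig v u \<and> (sig u v = 1 \<or> sig u v = -1))"

definition connected_graph :: "'a set \<Rightarrow> ('a \<Rightarrow> 'a \<Rightarrow> bool) \<Rightarrow> bool" where
  "connected_graph V E \<longleftrightarrow> V \<noteq> {} \<and> (\<forall>u\<in>V. \<forall>v\<in>V. E\<^sup>*\<^sup>* u v)"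

text \<open>Adjacency matrix w.r.t. a fixed enumeration of V (the nullity does not
depend on the enumeration).\<close>
definition vertex_list :: "'a set \<Rightarrow> 'a list" where
  "vertex_list V = (SOME vs. distinct vs \<and> set vs = V)"

definition adj_matrix :: "'a set \<Rightarrow> ('a \<Rightarrow> 'a \<Rightarrow> bool) \<Rightarrow> ('a \<Rightarrow> 'a \<Rightarrow> real) \<Rightarrow> real mat" where
  "adj_matrix V E sig = (let vs = vertex_list V in
     mat (length vs) (length vs)
       (\<lambda>(i, j). if E (vs ! i) (vs ! j) then sig (vs ! i) (vs ! j) else 0))"

definition nullity :: "'a set \<Rightarrow> ('a \<Rightarrow> 'a \<Rightarrow> bool) \<Rightarrow> ('a \<Rightarrow> 'a \<Rightarrow> real) \<Rightarrow> nat" where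
  "nullity V E sig = order 0 (char_poly (adj_matrix V E sig))"

definition is_cycle :: "('a \<Rightarrow> 'a \<Rightarrow> bool) \<Rightarrow> 'a list \<Rightarrow> bool" where
  "is_cycle E cs \<longleftrightarrow> distinct cs \<and> length cs \<ge> 3
     \<and> (\<forall>i < length cs. E (cs ! i) (cs ! ((i + 1) mod length cs)))"

definition has_cycle :: "('a \<Rightarrow> 'a \<Rightarrow> bool) \<Rightarrow> bool" where
  "has_cycle E \<longleftrightarrow> (\<exists>cs. is_cycle E cs)"

definition girth :: "('a \<Rightarrow> 'a \<Rightarrow> bool) \<Rightarrow> nat" where
  "girth E = (LEAST k. \<exists>cs. is_cycle E cs \<and> length cs = k)"

definition cycle_sign :: "('a \<Rightarrow> 'a \<Rightarrow> real) \<Rightarrow> 'a list \<Rightarrow> real" where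
  "cycle_sign sig cs = (\<Prod>i\<leftarrow>[0..<length cs]. sig (cs ! i) (cs ! ((i + 1) mod length cs)))"

definition balanced_cycle :: "('a \<Rightarrow> 'a \<Rightarrow> real) \<Rightarrow> 'a list \<Rightarrow> bool" where
  "balanced_cycle sig cs \<longleftrightarrow> cycle_sign sig cs = 1"

definition graph_is_cycle :: "'a set \<Rightarrow> ('a \<Rightarrow> 'a \<Rightarrow> bool) \<Rightarrow> 'a list \<Rightarrow> bool" where
  "graph_is_cycle V E cs \<longleftrightarrow> is_cycle E cs \<and> set cs = V
     \<and> (\<forall>u v. E u v \<longleftrightarrow> (\<exists>i < length cs. (u = cs ! i \<and> v = cs ! ((i + 1) mod length cs))
                                         \<or> (v = cs ! i \<and> u = cs ! ((i + 1) mod length cs))))"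

definition complete_bipartite :: "'a set \<Rightarrow> ('a \<Rightarrow> 'a \<Rightarrow> bool) \<Rightarrow> bool" where
  "complete_bipartite V E \<longleftrightarrow> (\<exists>X Y. X \<noteq> {} \<and> Y \<noteq> {} \<and> X \<inter> Y = {} \<and> X \<union> Y = V
     \<and> (\<forall>u v. E u v \<longleftrightarrow> (u \<in> X \<and> v \<in> Y) \<or> (u \<in> Y \<and> v \<in> X)))"

definition switching_equiv_all_positive :: "'a set \<Rightarrow> ('a \<Rightarrow> 'a \<Rightarrow> bool) \<Rightarrow> ('a \<Rightarrow> 'a \<Rightarrow> real) \<Rightarrow> bool" where
  "switching_equiv_all_positive V E sig \<longleftrightarrow> (\<exists>\<theta>::'a \<Rightarrow> real. (\<forall>v\<in>V. \<theta> v = 1 \<or> \<theta> v = -1)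
     \<and> (\<forall>u v. E u v \<longrightarrow> \<theta> u * sig u v * \<theta> v = 1))"

end

theory Submission
  imports Defs "HOL-Library.Function_Algebras"
begin

text \<open>
  Write \<open>A\<close> for the adjacency matrix, \<open>n\<close> for its size and \<open>r\<close> for its rank. As \<open>A\<close> is symmetric, a
  rank factorisation \<open>A = P B\<close> has \<open>det (B P) \<noteq> 0\<close>, and comparing the characteristic polynomials of
  \<open>P B\<close> and \<open>B P\<close> shows that the nullity is \<open>n - r\<close>. So the claim is \<open>r \<ge> g - 2\<close> with a
  description of equality. An induced path on an even number \<open>k\<close> of vertices gives \<open>k\<close> independent
  rows, and a shortest cycle contains such a path with \<open>g - 1\<close> (\<open>g\<close> odd) or \<open>g - 2\<close> (\<open>g\<close> even)
  vertices. If \<open>r = g - 2\<close>, then \<open>g\<close> is even. For \<open>g = 4\<close> the rows of the ends of any edge span all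
  rows, and the zero diagonal forces every row to be \<open>\<plusminus>\<close> one of these two. For \<open>g \<ge> 6\<close> a vertex
  attached to the cycle would produce an induced path on \<open>g\<close> vertices, so the graph is the cycle;
  there a kernel vector satisfies a two-step recurrence that closes up around the cycle iff the
  sign of the cycle is \<open>(- 1) ^ (g div 2)\<close>.
\<close>

subsection \<open>The nullity of a symmetric matrix and its rank\<close>

text \<open>Both sides equal \<open>x ^ r * det M\<close> for the block matrix \<open>M\<close> with
  rows \<open>x I, P\<close> and \<open>B, I\<close>. Multiplying \<open>M\<close> by a block
  triangular matrix clears its lower left block: on the right by one of determinant
  \<open>1\<close>, on the left by one of determinant \<open>x ^ r\<close>. No division by
  \<open>x\<close> occurs.\<close>

lemma det_scalar_minus_mult_swap:
  fixes P B :: "'b :: idom mat"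
  assumes P: "P \<in> carrier_mat n r" and B: "B \<in> carrier_mat r n"
  shows "x ^ r * det (x \<cdot>\<^sub>m 1\<^sub>m n - P * B) = x ^ n * det (x \<cdot>\<^sub>m 1\<^sub>m r - B * P)"
proof -
  let ?M = "four_block_mat (x \<cdot>\<^sub>m 1\<^sub>m n) P B (1\<^sub>m r)"
  let ?R = "four_block_mat (1\<^sub>m n) (0\<^sub>m n r) (- B) (1\<^sub>m r)"
  let ?L = "four_block_mat (1\<^sub>m n) (0\<^sub>m n r) (- B) (x \<cdot>\<^sub>m 1\<^sub>m r)"
  have cM: "?M \<in> carrier_mat (n + r) (n + r)" and cR: "?R \<in> carrier_mat (n + r) (n + r)"
    and cL: "?L \<in> carrier_mat (n + r) (n + r)" using P B by auto
  have PB: "P * - B = - (P * B)" "- B * P = - (B * P)"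
    using P B by auto
  have MR: "?M * ?R = four_block_mat (x \<cdot>\<^sub>m 1\<^sub>m n - P * B) P (0\<^sub>m r n) (1\<^sub>m r)"
    by (subst mult_four_block_mat[where ?nr1.0 = n and ?n1.0 = n and ?n2.0 = r and ?nr2.0 = r
          and ?nc1.0 = n and ?nc2.0 = r])
      (use P B in \<open>auto simp: PB minus_add_uminus_mat[symmetric] intro!: cong_four_block_mat\<close>)
  have LM: "?L * ?M = four_block_mat (x \<cdot>\<^sub>m 1\<^sub>m n) P (0\<^sub>m r n) (x \<cdot>\<^sub>m 1\<^sub>m r - B * P)"
    by (subst mult_four_block_mat[where ?nr1.0 = n and ?n1.0 = n and ?n2.0 = r and ?nr2.0 = r
          and ?nc1.0 = n and ?nc2.0 = r])
      (use P B in \<open>auto simp: PB intro!: cong_four_block_mat eq_matI\<close>)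
  have "det ?R = 1"
    using det_four_block_mat_upper_right_zero[of "1\<^sub>m n" n "0\<^sub>m n r" r "- B" "1\<^sub>m r"] B by auto
  moreover have "det ?L = x ^ r"
    using det_four_block_mat_upper_right_zero[of "1\<^sub>m n" n "0\<^sub>m n r" r "- B" "x \<cdot>\<^sub>m 1\<^sub>m r"] B by auto
  moreover have "det (?M * ?R) = det (x \<cdot>\<^sub>m 1\<^sub>m n - P * B)"
    unfolding MR
    using det_four_block_mat_lower_left_zero[of "x \<cdot>\<^sub>m 1\<^sub>m n - P * B" n P r "0\<^sub>m r n" "1\<^sub>m r"] P B
    by (simp add: minus_carrier_mat)
  moreover have "det (?L * ?M) = x ^ n * det (x \<cdot>\<^sub>m 1\<^sub>m r - B * P)"
    unfolding LM
    using det_four_block_mat_lower_left_zero[of "x \<cdot>\<^sub>m 1\<^sub>m n" n P r "0\<^sub>m r n" "x \<cdot>\<^sub>m 1\<^sub>m r - B * P"] P B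
    by (simp add: minus_carrier_mat)
  ultimately show ?thesis
    using det_mult[OF cM cR] det_mult[OF cL cM] by simp
qed

text \<open>The determinant identity is used over the polynomial ring, with the indeterminate for
  \<open>x\<close>; an integral domain suffices there.\<close>

lemma char_poly_mult_swap:
  fixes P B :: "'b :: idom mat"
  assumes P: "P \<in> carrier_mat n r" and B: "B \<in> carrier_mat r n"
  shows "[:0, 1:] ^ r * char_poly (P * B) = [:0, 1:] ^ n * char_poly (B * P)"
proof -
  let ?c = "map_mat (\<lambda>a. [:a:] :: 'b poly)"
  have "char_poly_matrix (P * B) = [:0, 1:] \<cdot>\<^sub>m 1\<^sub>m n - ?c P * ?c B"
    unfolding char_poly_matrix_def map_poly_mult(1)[OF P B, symmetric]
    by (rule eq_matI) (use P B in auto)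
  moreover have "char_poly_matrix (B * P) = [:0, 1:] \<cdot>\<^sub>m 1\<^sub>m r - ?c B * ?c P"
    unfolding char_poly_matrix_def map_poly_mult(1)[OF B P, symmetric]
    by (rule eq_matI) (use P B in auto)
  ultimately show ?thesis
    unfolding char_poly_def
    using det_scalar_minus_mult_swap[of "?c P" n r "?c B" "[:0, 1:]"] P B by simp
qed

text \<open>As \<open>B * P\<close> is nonsingular, \<open>0\<close> is not a root of its
  characteristic polynomial. Comparing the orders at \<open>0\<close> of both sides of
  \<open>char_poly_mult_swap\<close> then gives the claim.\<close>

lemma order_zero_char_poly_mult:
  fixes P B :: "'b :: field mat"
  assumes P: "P \<in> carrier_mat n r" and B: "B \<in> carrier_mat r n" and det: "det (B * P) \<noteq> 0"
  shows "order 0 (char_poly (P * B)) + r = n"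
proof -
  have BP: "B * P \<in> carrier_mat r r" and PB: "P * B \<in> carrier_mat n n" using P B by auto
  have "\<not> eigenvalue (B * P) 0"
    using det_0_iff_vec_prod_zero_field[OF BP] det BP
    by (fastforce simp: eigenvalue_def eigenvector_def)
  then have z: "order 0 (char_poly (B * P)) = 0"
    using eigenvalue_root_char_poly[OF BP] order_0I by blast
  have nz: "char_poly (B * P) \<noteq> 0" "char_poly (P * B) \<noteq> 0"
    using degree_monic_char_poly[OF BP] degree_monic_char_poly[OF PB]
    by (metis coeff_0 zero_neq_one)+
  have X: "order 0 ([:0, 1:] ^ k :: 'b poly) = k" for k
    using order_power_n_n[of "0 :: 'b" k] by simp
  have "order 0 ([:0, 1:] ^ r * char_poly (P * B)) = order 0 ([:0, 1:] ^ n * char_poly (B * P))"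
    by (simp only: char_poly_mult_swap[OF P B])
  then show ?thesis
    using nz z X by (simp add: order_mult)
qed

section \<open>Linear combinations of finite families of real functions\<close>

interpretation fun_vs: vector_space "\<lambda>(c::real) (f::'a \<Rightarrow> real) x. c * f x"
  by unfold_locales (auto simp: fun_eq_iff algebra_simps)

lemma sum_fun_apply: "(\<Sum>i\<in>I. f i) x = (\<Sum>i\<in>I. f i x :: 'b :: comm_monoid_add)"
  by (induction I rule: infinite_finite_induct) auto

text \<open>Turns independence of a set of functions into a condition on coefficients indexed by
  \<open>T\<close>. Injectivity belongs to the left side because two equal members of the family are
  already a dependence, with coefficients \<open>1\<close> and \<open>- 1\<close>.\<close>

lemma independent_image_iff:
  fixes f :: "'b \<Rightarrow> 'a \<Rightarrow> real"
  assumes T: "finite T"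
  shows "inj_on f T \<and> fun_vs.independent (f ` T) \<longleftrightarrow>
    (\<forall>c. (\<forall>x. (\<Sum>t\<in>T. c t * f t x) = 0) \<longrightarrow> (\<forall>t\<in>T. c t = 0))" (is "?L \<longleftrightarrow> ?R")
proof
  assume L: ?L
  show ?R
  proof (intro allI impI ballI)
    fix c t assume c: "\<forall>x. (\<Sum>t\<in>T. c t * f t x) = 0" and t: "t \<in> T"
    have inj: "inj_on f T" using L by blast
    have "(\<Sum>v\<in>f ` T. (\<lambda>x. c (inv_into T f v) * v x)) = 0"
      unfolding sum.reindex[OF inj] using c inj by (simp add: fun_eq_iff sum_fun_apply)
    then have "c (inv_into T f (f t)) = 0"
      using fun_vs.independentD[of "f ` T" "f ` T" "\<lambda>v. c (inv_into T f v)" "f t"] L T t by auto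
    then show "c t = 0" using inj t by simp
  qed
next
  assume R: ?R
  have inj: "inj_on f T"
  proof (rule inj_onI, rule ccontr)
    fix a b assume ab: "a \<in> T" "b \<in> T" "f a = f b" "a \<noteq> b"
    let ?c = "\<lambda>t. if t = a then 1 else if t = b then - 1 else (0 :: real)"
    have "(\<Sum>t\<in>T. ?c t * f t x) = (\<Sum>t\<in>{a, b}. ?c t * f t x)" for x
      by (rule sum.mono_neutral_right) (use T ab in auto)
    then have "(\<Sum>t\<in>T. ?c t * f t x) = 0" for x using ab by simp
    then show False using R[rule_format, of ?c a] ab by auto
  qed
  have "fun_vs.independent (f ` T)"
  proof (rule fun_vs.independent_if_scalars_zero)
    fix c v assume c: "(\<Sum>v\<in>f ` T. (\<lambda>x. c v * v x)) = 0" and v: "v \<in> f ` T"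
    then obtain t where t: "t \<in> T" "v = f t" by auto
    have "(\<Sum>t\<in>T. c (f t) * f t x) = 0" for x
      using c inj by (simp add: fun_eq_iff sum_fun_apply sum.reindex)
    then show "c v = 0" using R[rule_format, of "\<lambda>t. c (f t)"] t by auto
  qed (use T in simp)
  with inj show ?L by blast
qed

text \<open>Since \<open>f\<close> may repeat values, the coefficients come from a subset
  \<open>U\<close> of \<open>T\<close> on which \<open>f\<close> is injective with the same image;
  they are extended by \<open>0\<close>.\<close>

lemma in_span_image_iff:
  fixes f :: "'b \<Rightarrow> 'a \<Rightarrow> real"
  assumes T: "finite T"
  shows "g \<in> fun_vs.span (f ` T) \<longleftrightarrow> (\<exists>c. \<forall>x. g x = (\<Sum>t\<in>T. c t * f t x))" (is "?L \<longleftrightarrow> ?R")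
proof
  assume ?L
  then obtain U where U: "U \<subseteq> T" "inj_on f U" "f ` T = f ` U"
    using subset_image_inj[of "f ` T" f T] by blast
  from \<open>?L\<close> obtain u where "g = (\<Sum>v\<in>f ` U. (\<lambda>x. u v * v x))"
    using fun_vs.span_finite[of "f ` U"] U finite_subset[OF U(1) T] by auto
  then have "g x = (\<Sum>t\<in>U. u (f t) * f t x)" for x
    by (simp add: sum_fun_apply sum.reindex[OF U(2)])
  also have "(\<Sum>t\<in>U. u (f t) * f t x) = (\<Sum>t\<in>T. (if t \<in> U then u (f t) else 0) * f t x)" for x
    by (rule sum.mono_neutral_cong_left) (use U T in auto)
  finally show ?R by (intro exI[of _ "\<lambda>t. if t \<in> U then u (f t) else 0"]) blast
next
  assume ?R
  then obtain c where c: "\<forall>x. g x = (\<Sum>t\<in>T. c t * f t x)" by blast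
  have "g = (\<Sum>t\<in>T. (\<lambda>x. c t * f t x))"
    using c by (simp add: fun_eq_iff sum_fun_apply)
  also have "\<dots> \<in> fun_vs.span (f ` T)"
    by (intro fun_vs.span_sum fun_vs.span_scale fun_vs.span_base) auto
  finally show ?L .
qed

text \<open>Symmetry makes \<open>B * P\<close> nonsingular. If \<open>B P x = 0\<close> and
  \<open>y = P x\<close>, then \<open>P B y = 0\<close>; transposing and cancelling the transpose of
  \<open>B\<close> shows that the transpose of \<open>P\<close> kills \<open>y\<close>. Hence
  \<open>y\<close> is orthogonal to \<open>P x = y\<close>, so \<open>y = 0\<close> over the reals,
  and \<open>x = 0\<close>.\<close>

lemma order_zero_char_poly_symmetric:
  fixes P B :: "real mat"
  assumes P: "P \<in> carrier_mat n r" and B: "B \<in> carrier_mat r n"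
    and sym: "transpose_mat (P * B) = P * B"
    and injP: "\<And>x. x \<in> carrier_vec r \<Longrightarrow> P *\<^sub>v x = 0\<^sub>v n \<Longrightarrow> x = 0\<^sub>v r"
    and injB: "\<And>z. z \<in> carrier_vec r \<Longrightarrow> transpose_mat B *\<^sub>v z = 0\<^sub>v n \<Longrightarrow> z = 0\<^sub>v r"
  shows "order 0 (char_poly (P * B)) + r = n"
proof (rule order_zero_char_poly_mult[OF P B])
  have BP: "B * P \<in> carrier_mat r r" using P B by auto
  have "x = 0\<^sub>v r" if x: "x \<in> carrier_vec r" and 0: "(B * P) *\<^sub>v x = 0\<^sub>v r" for x
  proof -
    define y where "y = P *\<^sub>v x"
    have y: "y \<in> carrier_vec n" unfolding y_def using P x by auto
    have "B *\<^sub>v y = 0\<^sub>v r" unfolding y_def using 0 assoc_mult_mat_vec[OF B P x] by simp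
    then have "(P * B) *\<^sub>v y = 0\<^sub>v n" using assoc_mult_mat_vec[OF P B y] P by auto
    then have "transpose_mat B *\<^sub>v (transpose_mat P *\<^sub>v y) = 0\<^sub>v n"
      using assoc_mult_mat_vec[of "transpose_mat B" n r "transpose_mat P" n y] P B y sym
        transpose_mult[OF P B] by (metis transpose_carrier_mat)
    then have z: "transpose_mat P *\<^sub>v y = 0\<^sub>v r" using injB[of "transpose_mat P *\<^sub>v y"] P y by auto
    have "y \<bullet> y = x \<bullet> (transpose_mat P *\<^sub>v y)"
      using transpose_vec_mult_scalar[OF P x y] comm_scalar_prod[OF x] P y
      by (simp add: y_def[symmetric] comm_scalar_prod)
    then have "y \<bullet> y = 0" using z x by simp
    then have "y = 0\<^sub>v n" using conjugate_square_eq_0_vec[OF y] by simp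
    then show ?thesis using injP[OF x] unfolding y_def by blast
  qed
  then show "det (B * P) \<noteq> 0" using det_0_iff_vec_prod_zero_field[OF BP] by blast
qed

section \<open>The rank of the adjacency matrix\<close>

definition adj :: "('a \<Rightarrow> 'a \<Rightarrow> bool) \<Rightarrow> ('a \<Rightarrow> 'a \<Rightarrow> real) \<Rightarrow> 'a \<Rightarrow> 'a \<Rightarrow> real" where
  "adj E sig u v = (if E u v then sig u v else 0)"

text \<open>\<open>fun_vs.dim\<close> of a set is the dimension of its span, so this is the row
  rank, free of any enumeration of the vertices.\<close>

definition adj_rank :: "'a set \<Rightarrow> ('a \<Rightarrow> 'a \<Rightarrow> bool) \<Rightarrow> ('a \<Rightarrow> 'a \<Rightarrow> real) \<Rightarrow> nat" where
  "adj_rank V E sig = fun_vs.dim (adj E sig ` V)"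

lemma adj_sym: "signed_graph V E sig \<Longrightarrow> adj E sig u v = adj E sig v u"
  by (auto simp: adj_def signed_graph_def)

text \<open>A set \<open>S\<close> of vertices whose rows form a basis yields a factorisation
  \<open>A = P B\<close>: \<open>B\<close> consists of the rows of \<open>S\<close>, and
  \<open>P\<close> holds the coordinates of all rows in this basis.\<close>

lemma nullity_add_adj_rank:
  assumes sg: "signed_graph V E sig"
  shows "nullity V E sig + adj_rank V E sig = card V"
proof -
  let ?A = "adj E sig"
  have fin: "finite V" using sg by (simp add: signed_graph_def)
  define vs where "vs = vertex_list V"
  have vs: "distinct vs" "set vs = V"
    using someI_ex[of "\<lambda>vs. distinct vs \<and> set vs = V"] finite_distinct_list[OF fin]
    by (auto simp: vs_def vertex_list_def)
  define n where "n = length vs"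
  have n: "n = card V" using vs distinct_card unfolding n_def by fastforce
  obtain X where X: "X \<subseteq> ?A ` V" "fun_vs.independent X" "?A ` V \<subseteq> fun_vs.span X"
      "card X = adj_rank V E sig"
    using fun_vs.basis_exists unfolding adj_rank_def by blast
  then obtain S where S: "S \<subseteq> V" "inj_on ?A S" "X = ?A ` S"
    using subset_image_inj[of X ?A V] by blast
  obtain ss where ss: "distinct ss" "set ss = S"
    using finite_distinct_list[OF finite_subset[OF S(1) fin]] by blast
  define r where "r = length ss"
  define f where "f = (\<lambda>j. ?A (ss ! j))"
  have fX: "f ` {0..<r} = X"
    using ss S(3) by (force simp: f_def r_def in_set_conv_nth image_iff)
  have finj: "inj_on f {0..<r}"
    unfolding f_def
  proof (rule inj_onI)
    fix i j assume "i \<in> {0..<r}" "j \<in> {0..<r}" "?A (ss ! i) = ?A (ss ! j)"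
    then show "i = j"
      using inj_onD[OF S(2), of "ss ! i" "ss ! j"] ss
      by (auto simp: r_def nth_eq_iff_index_eq)
  qed
  have r: "r = adj_rank V E sig" using card_image[OF finj] fX X(4) by simp
  have indep: "\<And>c j. (\<And>x. (\<Sum>j = 0..<r. c j * f j x) = 0) \<Longrightarrow> j < r \<Longrightarrow> c j = 0"
    using independent_image_iff[of "{0..<r}" f] finj fX X(2) by auto
  have "\<exists>c. \<forall>x. ?A w x = (\<Sum>j = 0..<r. c j * f j x)" if "w \<in> V" for w
    using in_span_image_iff[of "{0..<r}" "?A w" f] X(3) fX that by auto
  then obtain p where p: "\<And>w x. w \<in> V \<Longrightarrow> ?A w x = (\<Sum>j = 0..<r. p w j * f j x)" by metis
  \<comment> \<open>The coordinates of a basis row are a unit vector. So \<open>P\<close> contains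
    an identity matrix among its rows, which makes it injective.\<close>
  have delta: "p (ss ! i) j = (if j = i then 1 else 0)" if i: "i < r" and j: "j < r" for i j
  proof -
    have iV: "ss ! i \<in> V" using i S(1) ss unfolding r_def by auto
    have "(\<Sum>j = 0..<r. (p (ss ! i) j - (if j = i then 1 else 0)) * f j x) = 0" for x
    proof -
      have "(\<Sum>j = 0..<r. (if j = i then 1 else 0) * f j x) = f i x"
        using i by (simp add: if_distrib[of "\<lambda>t. t * _"] cong: if_cong)
      then show ?thesis
        using p[OF iV, of x] by (simp add: left_diff_distrib sum_subtractf f_def)
    qed
    from indep[OF this j] show ?thesis by simp
  qed
  define P where "P = mat n r (\<lambda>(i, j). p (vs ! i) j)"
  define B where "B = mat r n (\<lambda>(j, k). f j (vs ! k))"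
  have P: "P \<in> carrier_mat n r" and B: "B \<in> carrier_mat r n" by (auto simp: P_def B_def)
  have nthV: "vs ! i \<in> V" if "i < n" for i using vs that unfolding n_def by auto
  have PB: "adj_matrix V E sig = P * B"
    by (rule eq_matI)
      (auto simp: adj_matrix_def Let_def vs_def[symmetric] n_def[symmetric] P_def B_def
        scalar_prod_def p[symmetric] nthV adj_def)
  have sym: "transpose_mat (P * B) = P * B"
    unfolding PB[symmetric]
    by (rule eq_matI)
      (use sg in \<open>auto simp: adj_matrix_def Let_def signed_graph_def\<close>)
  have "order 0 (char_poly (P * B)) + r = n"
  proof (rule order_zero_char_poly_symmetric[OF P B sym])
    fix x assume x: "x \<in> carrier_vec r" and 0: "P *\<^sub>v x = 0\<^sub>v n"
    show "x = 0\<^sub>v r"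
    proof (rule eq_vecI)
      fix j assume "j < dim_vec (0\<^sub>v r :: real vec)"
      then have j: "j < r" by simp
      then have "ss ! j \<in> set vs" using S(1) ss vs unfolding r_def by auto
      then obtain i where i: "i < n" "vs ! i = ss ! j" unfolding n_def in_set_conv_nth by blast
      have "0 = (P *\<^sub>v x) $ i" using 0 i by simp
      also have "\<dots> = (\<Sum>k = 0..<r. p (ss ! j) k * x $ k)"
        using i x by (simp add: P_def scalar_prod_def)
      also have "\<dots> = (\<Sum>k = 0..<r. if k = j then x $ k else 0)"
        by (rule sum.cong) (use delta[OF j] in auto)
      also have "\<dots> = x $ j" using j by simp
      finally show "x $ j = 0\<^sub>v r $ j" using j by simp
    qed (use x in simp)
  next
    fix z assume z: "z \<in> carrier_vec r" and 0: "transpose_mat B *\<^sub>v z = 0\<^sub>v n"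
    \<comment> \<open>The matrix equation speaks of vertices only, whereas independence was stated
      for functions on the whole type; outside \<open>V\<close> all rows vanish.\<close>
    have sum0: "(\<Sum>j = 0..<r. z $ j * f j x) = 0" for x
    proof (cases "x \<in> V")
      case True
      then have "x \<in> set vs" using vs by simp
      then obtain k where k: "k < n" "vs ! k = x" unfolding n_def in_set_conv_nth by blast
      have "0 = (transpose_mat B *\<^sub>v z) $ k" using 0 k by simp
      also have "\<dots> = (\<Sum>j = 0..<r. z $ j * f j x)"
        using k z by (simp add: B_def scalar_prod_def mult.commute)
      finally show ?thesis by simp
    next
      case False
      then have "f j x = 0" for j using sg by (auto simp: f_def adj_def signed_graph_def)
      then show ?thesis by simp
    qed
    show "z = 0\<^sub>v r"
      by (rule eq_vecI) (use indep[OF sum0] z in auto)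
  qed
  then show ?thesis unfolding nullity_def PB r n by simp
qed

lemma adj_rank_le:
  assumes "finite T" and "\<And>w. w \<in> V \<Longrightarrow> \<exists>c. \<forall>x. adj E sig w x = (\<Sum>t\<in>T. c t * adj E sig t x)"
  shows "adj_rank V E sig \<le> card T"
proof -
  have "adj E sig ` V \<subseteq> fun_vs.span (adj E sig ` T)"
    using assms by (auto simp: in_span_image_iff)
  then show ?thesis
    unfolding adj_rank_def
    using fun_vs.dim_le_card[of "adj E sig ` V" "adj E sig ` T"] assms(1) card_image_le[of T]
    by (meson finite_imageI le_trans)
qed

text \<open>Independent rows extend to no larger independent set once their number is the rank, so
  then they span. The first part, read backwards with \<open>T = V\<close>, also produces a kernel
  vector whenever the rank is below \<open>card V\<close>.\<close>

lemma adj_rank_ge: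
  assumes V: "finite V" and T: "T \<subseteq> V"
    and indep: "\<And>c t. (\<And>x. (\<Sum>t\<in>T. c t * adj E sig t x) = 0) \<Longrightarrow> t \<in> T \<Longrightarrow> c t = 0"
  shows "card T \<le> adj_rank V E sig"
    and "card T = adj_rank V E sig \<Longrightarrow> w \<in> V \<Longrightarrow>
      \<exists>c. \<forall>x. adj E sig w x = (\<Sum>t\<in>T. c t * adj E sig t x)"
proof -
  let ?A = "adj E sig"
  have fT: "finite T" using V T finite_subset by blast
  have T': "inj_on ?A T" "fun_vs.independent (?A ` T)"
    using independent_image_iff[OF fT, of ?A] indep by blast+
  obtain X where X: "X \<subseteq> ?A ` V" "?A ` V \<subseteq> fun_vs.span X" "card X = adj_rank V E sig"
    unfolding adj_rank_def by (rule fun_vs.basis_exists[of "?A ` V"])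
  have fX: "finite X" using finite_subset[OF X(1)] V by simp
  have bound: "card Y \<le> adj_rank V E sig" if "fun_vs.independent Y" "Y \<subseteq> ?A ` V" for Y
    using fun_vs.independent_span_bound[OF fX that(1)] that(2) X by auto
  show "card T \<le> adj_rank V E sig" using bound[OF T'(2)] T card_image[OF T'(1)] by auto
  assume eq: "card T = adj_rank V E sig" and w: "w \<in> V"
  have "?A w \<in> fun_vs.span (?A ` T)"
  proof (rule ccontr)
    assume nin: "?A w \<notin> fun_vs.span (?A ` T)"
    then have "fun_vs.independent (insert (?A w) (?A ` T))"
      using T'(2) fun_vs.independent_insertI by blast
    then have "card (insert (?A w) (?A ` T)) \<le> adj_rank V E sig" using bound T w by blast
    moreover have "?A w \<notin> ?A ` T" using nin fun_vs.span_base by blast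
    ultimately show False using fT eq card_image[OF T'(1)] by simp
  qed
  then show "\<exists>c. \<forall>x. ?A w x = (\<Sum>t\<in>T. c t * ?A t x)" using in_span_image_iff[OF fT] by blast
qed

subsection \<open>Shortest cycles and induced paths\<close>

lemma signed_graph_adj:
  assumes "signed_graph V E sig" "E u v"
  shows "u \<in> V" "v \<in> V" "E v u" "u \<noteq> v" "sig u v = sig v u" "sig u v \<noteq> 0" "sig u v * sig u v = 1"
proof -
  show "u \<in> V" "v \<in> V" "E v u" "u \<noteq> v" "sig u v = sig v u"
    using assms unfolding signed_graph_def by blast+
  have "sig u v = 1 \<or> sig u v = - 1" using assms unfolding signed_graph_def by blast
  then show "sig u v \<noteq> 0" "sig u v * sig u v = 1" by auto
qed

text \<open>A form without modular indices, suited to cutting cycles into arcs and gluing arcs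
  together.\<close>

lemma is_cycle_iff:
  "is_cycle E cs \<longleftrightarrow> distinct cs \<and> length cs \<ge> 3 \<and> successively E cs \<and> E (last cs) (hd cs)"
proof (cases "length cs \<ge> 3")
  case True
  then have ne: "cs \<noteq> []" by auto
  have "(\<forall>i < length cs. E (cs ! i) (cs ! ((i + 1) mod length cs))) \<longleftrightarrow>
      successively E cs \<and> E (last cs) (hd cs)" (is "?L \<longleftrightarrow> ?R")
  proof
    assume L: ?L
    have "E (cs ! i) (cs ! Suc i)" if "Suc i < length cs" for i
      using L[rule_format, of i] that by simp
    moreover have "E (last cs) (hd cs)"
      using L[rule_format, of "length cs - 1"] ne by (simp add: last_conv_nth hd_conv_nth)
    ultimately show ?R by (simp add: successively_conv_nth)
  next
    assume R: ?R
    show ?L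
    proof (intro allI impI)
      fix i assume i: "i < length cs"
      show "E (cs ! i) (cs ! ((i + 1) mod length cs))"
      proof (cases "Suc i < length cs")
        case True
        then show ?thesis using R by (simp add: successively_conv_nth)
      next
        case False
        then have "i = length cs - 1" using i by simp
        then show ?thesis using R ne by (simp add: last_conv_nth hd_conv_nth)
      qed
    qed
  qed
  then show ?thesis by (simp add: is_cycle_def True)
qed (simp add: is_cycle_def)

lemma cycle_subset:
  assumes "signed_graph V E sig" and "is_cycle E cs"
  shows "set cs \<subseteq> V"
proof
  fix x assume "x \<in> set cs"
  then obtain i where "i < length cs" "x = cs ! i" by (auto simp: in_set_conv_nth)
  then show "x \<in> V" using assms signed_graph_adj(1) unfolding is_cycle_def by metis
qed

lemma is_cycle_rotate1: "is_cycle E cs \<Longrightarrow> is_cycle E (rotate1 cs)"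
  by (cases cs) (auto simp: is_cycle_iff successively_append_iff successively_Cons hd_append
      split: if_splits)

lemma is_cycle_rotate: "is_cycle E cs \<Longrightarrow> is_cycle E (rotate n cs)"
  by (induction n) (auto intro: is_cycle_rotate1)

lemma is_cycle_from:
  assumes "is_cycle E cs" "x \<in> set cs"
  obtains ds where "is_cycle E (x # ds)" "set (x # ds) = set cs" "length (x # ds) = length cs"
proof -
  obtain i where i: "i < length cs" "cs ! i = x" using assms(2) by (auto simp: in_set_conv_nth)
  have "hd (rotate i cs) = x"
    using i hd_rotate_conv_nth[of cs i] by (cases cs) auto
  moreover have "rotate i cs \<noteq> []" using i by auto
  ultimately obtain ds where "rotate i cs = x # ds" by (metis list.collapse)
  then show ?thesis using that is_cycle_rotate[OF assms(1), of i]
    by (metis length_rotate set_rotate)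
qed

lemma girth_le: "is_cycle E cs \<Longrightarrow> girth E \<le> length cs"
  unfolding girth_def by (rule Least_le) blast

lemma girth_cycle:
  assumes "has_cycle E"
  obtains cs where "is_cycle E cs" "length cs = girth E"
  using LeastI_ex[of "\<lambda>k. \<exists>cs. is_cycle E cs \<and> length cs = k"] assms
  unfolding girth_def has_cycle_def by blast

text \<open>A chord would close the segment from \<open>i\<close> to \<open>j\<close> to a cycle of
  length \<open>Suc j - i\<close>, which is less than the girth. The two alternatives are the edges
  of the cycle itself.\<close>

lemma shortest_cycle_chordless:
  assumes sg: "signed_graph V E sig" and c: "is_cycle E cs" and len: "length cs = girth E"
    and ij: "i < j" "j < length cs" "E (cs ! i) (cs ! j)"
  shows "j = Suc i \<or> i = 0 \<and> j = length cs - 1"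
proof (rule ccontr)
  assume neg: "\<not> ?thesis"
  define ds where "ds = take (Suc j - i) (drop i cs)"
  have lds: "length ds = Suc j - i" using ij by (simp add: ds_def)
  have nth: "ds ! k = cs ! (i + k)" if "k < length ds" for k
    using that ij by (simp add: ds_def)
  have "distinct ds" using c by (simp add: ds_def is_cycle_def distinct_take distinct_drop)
  moreover have "successively E ds"
    using c ij unfolding is_cycle_iff successively_conv_nth by (simp add: lds nth)
  moreover have "last ds = cs ! j" "hd ds = cs ! i"
    using lds ij nth[of 0] nth[of "length ds - 1"]
    by (cases "ds = []"; simp add: last_conv_nth hd_conv_nth)+
  ultimately have "is_cycle E ds"
    unfolding is_cycle_iff using lds ij neg signed_graph_adj(3)[OF sg ij(3)] by auto
  then have "girth E \<le> Suc j - i" using girth_le lds by metis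
  then show False using len ij neg by auto
qed

text \<open>The two arcs of the cycle, each closed up through \<open>w\<close>, have total length \<open>girth E + 4\<close>.\<close>

lemma shortest_cycle_unique_neighbour:
  assumes sg: "signed_graph V E sig" and c: "is_cycle E (x # cs)" and len: "length (x # cs) = girth E"
    and g: "girth E > 4" and w: "w \<notin> set (x # cs)" "E w x" and y: "y \<in> set cs"
  shows "\<not> E w y"
proof
  assume Ewy: "E w y"
  obtain as bs where cs: "cs = as @ y # bs" using y split_list by metis
  have "successively E ((x # as) @ y # bs)" and last: "E (last (y # bs)) x"
    and dist: "distinct (x # as @ y # bs)"
    using c by (auto simp: is_cycle_iff cs)
  then have succ: "successively E (x # as)" "successively E (y # bs)" "E (last (x # as)) y"
    unfolding successively_append_iff by auto
  have "successively E (w # (x # as) @ [y])"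
    using succ w unfolding successively_append_iff successively_Cons[of E w] by simp
  then have "is_cycle E (w # (x # as) @ [y])"
    unfolding is_cycle_iff using dist w(1) signed_graph_adj(3)[OF sg Ewy] by (auto simp: cs)
  moreover have "successively E (w # (y # bs) @ [x])"
    using succ last Ewy unfolding successively_append_iff successively_Cons[of E w] by simp
  then have "is_cycle E (w # (y # bs) @ [x])"
    unfolding is_cycle_iff using dist w(1) signed_graph_adj(3)[OF sg w(2)] by (auto simp: cs)
  ultimately have "girth E \<le> length as + 3" "girth E \<le> length bs + 3"
    by (fastforce dest: girth_le)+
  then show False using g len cs by simp
qed

section \<open>Induced paths as lower bounds for the rank\<close>

definition induced_path :: "('a \<Rightarrow> 'a \<Rightarrow> bool) \<Rightarrow> 'a list \<Rightarrow> bool" where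
  "induced_path E ps \<longleftrightarrow> distinct ps \<and>
    (\<forall>i < length ps. \<forall>j < length ps. E (ps ! i) (ps ! j) \<longleftrightarrow> i = Suc j \<or> j = Suc i)"

text \<open>At the vertex in position \<open>j\<close> the relation involves only the coefficients
  in positions \<open>j - 1\<close> and \<open>j + 1\<close>. Each end of the path has a single
  neighbour, so zeros spread in steps of two from both ends.\<close>

lemma induced_path_even_independent:
  assumes sg: "signed_graph V E sig" and ps: "induced_path E ps" and even: "even (length ps)"
    and zero: "\<And>x. (\<Sum>t\<in>set ps. c t * adj E sig t x) = 0" and t: "t \<in> set ps"
  shows "c t = 0"
proof -
  define m where "m = length ps"
  have E: "E (ps ! i) (ps ! j) \<longleftrightarrow> i = Suc j \<or> j = Suc i" if "i < m" "j < m" for i j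
    using ps that by (simp add: induced_path_def m_def)
  have nz: "sig (ps ! i) (ps ! j) \<noteq> 0" if "i < m" "j < m" "i = Suc j \<or> j = Suc i" for i j
    using E[of i j] that signed_graph_adj(6)[OF sg] by blast
  have bij: "bij_betw ((!) ps) {..<m} (set ps)"
    using ps by (auto simp: induced_path_def m_def intro: bij_betw_nth)
  have sum: "(\<Sum>i<m. c (ps ! i) * adj E sig (ps ! i) x) = 0" for x
    using zero[of x] sum.reindex_bij_betw[OF bij, of "\<lambda>t. c t * adj E sig t x"] by simp
  have restrict: "(\<Sum>i<m. c (ps ! i) * adj E sig (ps ! i) (ps ! j))
      = (\<Sum>i\<in>{i. i < m \<and> (i = Suc j \<or> j = Suc i)}. c (ps ! i) * sig (ps ! i) (ps ! j))" if "j < m" for j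
    by (rule sum.mono_neutral_cong_right) (use E that in \<open>auto simp: adj_def\<close>)
  have odd0: "Suc (2 * k) < m \<Longrightarrow> c (ps ! Suc (2 * k)) = 0" for k
  proof (induction k)
    case 0
    have "{i. i < m \<and> (i = Suc 0 \<or> 0 = Suc i)} = {Suc 0}" using 0 by auto
    then show ?case using sum[of "ps ! 0"] restrict[of 0] nz[of "Suc 0" 0] 0 by simp
  next
    case (Suc k)
    let ?j = "2 * Suc k"
    have "{i. i < m \<and> (i = Suc ?j \<or> ?j = Suc i)} = {Suc ?j, Suc (2 * k)}" using Suc.prems by auto
    then show ?case
      using sum[of "ps ! ?j"] restrict[of ?j] nz[of "Suc ?j" ?j] Suc by simp
  qed
  \<comment> \<open>Here the induction runs backwards from the last vertex, whose only neighbour has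
    position \<open>m - 2\<close>. As \<open>m\<close> is even, the positions
    \<open>m - 2 - 2 * k\<close> are exactly the even ones.\<close>
  have even0: "2 * k < m \<Longrightarrow> c (ps ! (m - 2 - 2 * k)) = 0" for k
  proof (induction k)
    case 0
    then have m: "m \<ge> 2" using even unfolding m_def[symmetric] by presburger
    then have "{i. i < m \<and> (i = Suc (m - 1) \<or> m - 1 = Suc i)} = {m - 2}" by auto
    moreover have "sig (ps ! (m - 2)) (ps ! (m - 1)) \<noteq> 0" by (rule nz) (use m in auto)
    ultimately show ?case
      using sum[of "ps ! (m - 1)"] restrict[of "m - 1"] m by simp
  next
    case (Suc k)
    let ?j = "m - 2 - 2 * Suc k"
    have m: "m \<ge> 2 * Suc k + 2" using Suc.prems even unfolding m_def[symmetric] by presburger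
    then have "{i. i < m \<and> (i = Suc (Suc ?j) \<or> Suc ?j = Suc i)} = {m - 2 - 2 * k, ?j}" by auto
    moreover have "?j \<noteq> m - 2 - 2 * k" using m by auto
    ultimately show ?case
      using sum[of "ps ! Suc ?j"] restrict[of "Suc ?j"] nz[of ?j "Suc ?j"] Suc.IH m by simp
  qed
  obtain i where i: "i < m" "t = ps ! i" using t by (auto simp: in_set_conv_nth m_def)
  show ?thesis
  proof (cases "even i")
    case True
    have "2 * ((m - 2 - i) div 2) = m - 2 - i" "i \<le> m - 2"
      using True i even unfolding m_def[symmetric] by presburger+
    then have "m - 2 - 2 * ((m - 2 - i) div 2) = i" "2 * ((m - 2 - i) div 2) < m" using i by auto
    then show ?thesis using even0 i by metis
  next
    case False
    then obtain k where "i = Suc (2 * k)" by (auto elim: oddE)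
    then show ?thesis using odd0 i by simp
  qed
qed

lemma induced_path_even_length_le_adj_rank:
  assumes sg: "signed_graph V E sig" and "induced_path E ps" and "even (length ps)" and "set ps \<subseteq> V"
  shows "length ps \<le> adj_rank V E sig"
proof -
  have "card (set ps) \<le> adj_rank V E sig"
    using adj_rank_ge(1)[of V "set ps" E sig] induced_path_even_independent[OF assms(1-3)] assms
    by (auto simp: signed_graph_def)
  then show ?thesis using assms(2) by (simp add: induced_path_def distinct_card)
qed

text \<open>A shortest cycle has no chords, and \<open>k < girth E\<close> leaves out its last
  vertex, so the closing edge does not occur either.\<close>

lemma induced_path_take:
  assumes sg: "signed_graph V E sig" and c: "is_cycle E cs" and len: "length cs = girth E"
    and k: "k < girth E"
  shows "induced_path E (take k cs)"
proof -
  have "E (cs ! i) (cs ! j) \<longleftrightarrow> i = Suc j \<or> j = Suc i" if ij: "i < k" "j < k" for i j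
  proof
    assume "E (cs ! i) (cs ! j)"
    then show "i = Suc j \<or> j = Suc i"
      using shortest_cycle_chordless[OF sg c len, of i j] shortest_cycle_chordless[OF sg c len, of j i]
        signed_graph_adj(3,4)[OF sg, of "cs ! i" "cs ! j"] ij k len
      by (cases i j rule: linorder_cases) auto
  next
    assume "i = Suc j \<or> j = Suc i"
    then show "E (cs ! i) (cs ! j)"
      using c ij k len signed_graph_adj(3)[OF sg] unfolding is_cycle_iff successively_conv_nth
      by auto
  qed
  then show ?thesis using c by (auto simp: induced_path_def is_cycle_def)
qed

lemma induced_path_Cons:
  assumes "induced_path E ps" and "w \<notin> set ps" and "\<not> E w w"
    and "\<And>j. j < length ps \<Longrightarrow> E w (ps ! j) \<longleftrightarrow> j = 0"
    and "\<And>j. j < length ps \<Longrightarrow> E (ps ! j) w \<longleftrightarrow> j = 0"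
  shows "induced_path E (w # ps)"
  unfolding induced_path_def
proof (intro conjI allI impI)
  fix i j assume "i < length (w # ps)" "j < length (w # ps)"
  then show "E ((w # ps) ! i) ((w # ps) ! j) \<longleftrightarrow> i = Suc j \<or> j = Suc i"
    using assms by (cases i; cases j) (auto simp: induced_path_def)
qed (use assms in \<open>auto simp: induced_path_def\<close>)

text \<open>For girth above four, \<open>x\<close> is the only neighbour of \<open>w\<close> on the
  cycle. With \<open>k = girth E - 1\<close> this yields a path on \<open>girth E\<close> vertices,
  too long for the equality case.\<close>

lemma induced_path_Cons_take:
  assumes sg: "signed_graph V E sig" and c: "is_cycle E (x # cs)" and len: "length (x # cs) = girth E"
    and g: "girth E > 4" and w: "w \<notin> set (x # cs)" "E w x" and k: "k < girth E" "0 < k"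
  shows "induced_path E (w # take k (x # cs))"
proof -
  have p: "induced_path E (take k (x # cs))" by (rule induced_path_take[OF sg c len k(1)])
  have irr: "\<not> E w w" using sg by (simp add: signed_graph_def)
  have w1: "E w (take k (x # cs) ! j) \<longleftrightarrow> j = 0" if "j < k" for j
  proof (cases j)
    case (Suc i)
    then have "take k (x # cs) ! j \<in> set cs" using that k len by simp
    then show ?thesis
      using shortest_cycle_unique_neighbour[OF sg c len g w] Suc by simp
  qed (use w k in \<open>auto simp: take_Cons'\<close>)
  have w2: "E (take k (x # cs) ! j) w \<longleftrightarrow> j = 0" if "j < k" for j
    using w1[OF that] signed_graph_adj(3)[OF sg] by blast
  have "w \<notin> set (take k (x # cs))" using w(1) in_set_takeD by fast
  moreover have "length (take k (x # cs)) = k" using k len by simp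
  ultimately show ?thesis
    using induced_path_Cons[OF p _ irr] w1 w2 by (simp del: take_Suc_Cons)
qed

text \<open>Only paths with an even number of vertices count. For odd girth one vertex of the cycle
  is dropped instead of two, which makes the bound strict.\<close>

lemma girth_le_adj_rank:
  assumes sg: "signed_graph V E sig" and hc: "has_cycle E"
  shows "girth E \<le> adj_rank V E sig + 2" and "odd (girth E) \<Longrightarrow> girth E < adj_rank V E sig + 2"
proof -
  obtain cs where cs: "is_cycle E cs" "length cs = girth E" using girth_cycle[OF hc] .
  have V: "set cs \<subseteq> V" by (rule cycle_subset[OF sg cs(1)])
  have *: "k \<le> adj_rank V E sig" if "even k" "k < girth E" for k
    using induced_path_even_length_le_adj_rank[OF sg induced_path_take[OF sg cs that(2)]] that cs V
      set_take_subset[of k cs] by auto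
  have "girth E \<ge> 3" using cs by (simp add: is_cycle_def)
  then show "girth E \<le> adj_rank V E sig + 2"
    using *[of "girth E - 2"] *[of "girth E - 1"] by (cases "even (girth E)") auto
  show "girth E < adj_rank V E sig + 2" if "odd (girth E)"
    using *[of "girth E - 1"] that \<open>girth E \<ge> 3\<close> by auto
qed

subsection \<open>Rank two and complete bipartite graphs\<close>

text \<open>A walk from a vertex of \<open>S\<close> to one outside must leave \<open>S\<close> at
  some edge.\<close>

lemma connected_boundary_edge:
  assumes sg: "signed_graph V E sig" and conn: "connected_graph V E"
    and S: "S \<subseteq> V" "S \<noteq> {}" "S \<noteq> V"
  obtains w x where "w \<in> V" "w \<notin> S" "x \<in> S" "E w x"
proof -
  obtain a b where ab: "a \<in> S" "b \<in> V" "b \<notin> S" using S by blast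
  have "E\<^sup>*\<^sup>* a b" using conn ab S unfolding connected_graph_def by blast
  then have "b \<in> S \<or> (\<exists>w x. w \<notin> S \<and> x \<in> S \<and> E x w)"
    by (induction rule: rtranclp_induct) (use ab in blast)+
  then show ?thesis using that ab signed_graph_adj(1,3)[OF sg] by blast
qed

lemma adj_neq_0_iff: "signed_graph V E sig \<Longrightarrow> adj E sig u v \<noteq> 0 \<longleftrightarrow> E u v"
  using signed_graph_adj(6)[of V E sig u v] by (simp add: adj_def)

text \<open>The rows of \<open>u\<close> and \<open>v\<close> are independent, hence span all rows.
  The vanishing diagonal makes each row a multiple of just one of them, and this choice splits
  \<open>V\<close> into the two parts.\<close>

lemma adj_rank_2_complete_bipartite:
  assumes sg: "signed_graph V E sig" and conn: "connected_graph V E"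
    and uv: "E u v" and r: "adj_rank V E sig = 2"
  shows "complete_bipartite V E \<and> switching_equiv_all_positive V E sig"
proof -
  let ?A = "adj E sig"
  note sym = adj_sym[OF sg] and nz = adj_neq_0_iff[OF sg]
  have V: "u \<in> V" "v \<in> V" "u \<noteq> v" and vu: "E v u" and irr: "\<And>x. \<not> E x x" and fin: "finite V"
    using signed_graph_adj[OF sg uv] sg by (auto simp: signed_graph_def)
  have path: "induced_path E [u, v]"
    using uv vu irr V(3) by (auto simp: induced_path_def nth_Cons' less_Suc_eq)
  have comb: "\<exists>a b. \<forall>x. ?A w x = a * ?A u x + b * ?A v x" if "w \<in> V" for w
    using adj_rank_ge(2)[OF fin, of "{u, v}" E sig w] that V r
      induced_path_even_independent[OF sg path] by auto
  have sq: "?A x y * ?A x y = 1" if "E x y" for x y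
    using signed_graph_adj(7)[OF sg that] that by (simp add: adj_def)
  have row: "(E w v \<and> \<not> E w u \<and> (\<forall>x. ?A w x = ?A w v * ?A u v * ?A u x)) \<or>
      (E w u \<and> \<not> E w v \<and> (\<forall>x. ?A w x = ?A w u * ?A u v * ?A v x))" if w: "w \<in> V" for w
  proof -
    obtain a b where ab: "\<And>x. ?A w x = a * ?A u x + b * ?A v x" using comb[OF w] by blast
    have s: "?A u v * ?A u v = 1" and s0: "?A u v \<noteq> 0" using sq[OF uv] by auto
    have diag: "?A x x = 0" for x using irr by (simp add: adj_def)
    have wu: "?A w u = b * ?A u v" and wv: "?A w v = a * ?A u v"
      using ab[of u] ab[of v] sym[of v u] diag by auto
    have a: "a = ?A w v * ?A u v" and b: "b = ?A w u * ?A u v"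
      using wu wv s by (auto simp: mult.assoc)
    \<comment> \<open>This is the diagonal entry at \<open>w\<close>: by symmetry both of its terms
      equal \<open>a * b * ?A u v\<close>.\<close>
    have "2 * (a * b * ?A u v) = 0"
      using ab[of w] diag[of w] sym[of u w] sym[of v w] wu wv by (simp add: algebra_simps)
    then have "a = 0 \<or> b = 0" using s0 by auto
    moreover have "\<not> (a = 0 \<and> b = 0)"
    proof
      \<comment> \<open>A zero row means an isolated vertex, which connectedness excludes as there
        are at least two vertices.\<close>
      assume "a = 0 \<and> b = 0"
      then have iso: "\<not> E w x" for x using ab[of x] nz[of w x] by simp
      obtain z where "z \<in> V" "z \<noteq> w" using V by metis
      then have "E\<^sup>*\<^sup>* w z" using conn w by (simp add: connected_graph_def)
      then show False using \<open>z \<noteq> w\<close> iso by (metis converse_rtranclpE)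
    qed
    ultimately consider "a \<noteq> 0" "b = 0" | "a = 0" "b \<noteq> 0" by blast
    then show ?thesis
    proof cases
      case 1
      then have "E w v" "\<not> E w u" using wu wv s0 nz[of w u] nz[of w v] by auto
      moreover have "?A w x = ?A w v * ?A u v * ?A u x" for x
        unfolding a[symmetric] using ab[of x] 1 by simp
      ultimately show ?thesis by blast
    next
      case 2
      then have "E w u" "\<not> E w v" using wu wv s0 nz[of w u] nz[of w v] by auto
      moreover have "?A w x = ?A w u * ?A u v * ?A v x" for x
        unfolding b[symmetric] using ab[of x] 2 by simp
      ultimately show ?thesis by blast
    qed
  qed
  define X where "X = {w \<in> V. E w v}"
  define Y where "Y = {w \<in> V. E w u}"
  have XY: "X \<inter> Y = {}" "X \<union> Y = V" using row unfolding X_def Y_def by blast+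
  have uX: "u \<in> X" "v \<in> Y" using V uv vu by (auto simp: X_def Y_def)
  have A_X: "?A w x = ?A w v * ?A u v * ?A u x" if "w \<in> X" for w x
    using row[of w] that unfolding X_def by blast
  have A_Y: "?A w x = ?A w u * ?A u v * ?A v x" if "w \<in> Y" for w x
    using row[of w] that unfolding Y_def by blast
  have E_X: "E w x \<longleftrightarrow> x \<in> Y" if "w \<in> X" for w x
  proof -
    have "E w x \<longleftrightarrow> E u x"
      using A_X[OF that, of x] nz[of w x] nz[of u x] nz[of w v] nz[of u v] that uv
      by (auto simp: X_def)
    then show ?thesis using signed_graph_adj(2,3)[OF sg] by (auto simp: Y_def)
  qed
  have E_Y: "E w x \<longleftrightarrow> x \<in> X" if "w \<in> Y" for w x
  proof -
    have "E w x \<longleftrightarrow> E v x"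
      using A_Y[OF that, of x] nz[of w x] nz[of v x] nz[of w u] nz[of u v] that uv
      by (auto simp: Y_def)
    then show ?thesis using signed_graph_adj(2,3)[OF sg] by (auto simp: X_def)
  qed
  have EXY: "E w x \<longleftrightarrow> w \<in> X \<and> x \<in> Y \<or> w \<in> Y \<and> x \<in> X" for w x
    using E_X[of w x] E_Y[of w x] XY signed_graph_adj(1)[OF sg, of w x] by blast
  have "complete_bipartite V E"
    unfolding complete_bipartite_def
    by (rule exI[of _ X], rule exI[of _ Y], intro conjI allI EXY) (use XY uX in auto)
  moreover have "switching_equiv_all_positive V E sig"
  proof -
    \<comment> \<open>For \<open>w\<close> in \<open>X\<close> and \<open>x\<close> in
      \<open>Y\<close> the row formula factors the entry as \<open>?A w v\<close> times
      \<open>?A x u * ?A u v\<close>; the switching takes these two factors.\<close>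
    define \<theta> where "\<theta> w = (if w \<in> X then ?A w v else ?A w u * ?A u v)" for w
    have "\<theta> w = 1 \<or> \<theta> w = - 1" if w: "w \<in> V" for w
    proof -
      have "\<theta> w * \<theta> w = 1"
      proof (cases "w \<in> X")
        case True
        then show ?thesis using sq[of w v] by (simp add: \<theta>_def X_def)
      next
        case False
        then have "E w u" using w XY by (auto simp: Y_def)
        have "(?A w u * ?A u v) * (?A w u * ?A u v) = (?A w u * ?A w u) * (?A u v * ?A u v)"
          by (simp add: algebra_simps)
        then show ?thesis using sq[OF \<open>E w u\<close>] sq[OF uv] False by (simp add: \<theta>_def)
      qed
      then show ?thesis by (simp add: square_eq_1_iff)
    qed
    moreover have *: "\<theta> w * ?A w x * \<theta> x = 1" if "w \<in> X" "x \<in> Y" for w x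
    proof -
      have "x \<notin> X" using that XY by blast
      then have "\<theta> w * ?A w x * \<theta> x
          = (?A w v * ?A w v) * (?A u v * ?A u v) * (?A x u * ?A x u)"
        using that A_X[OF that(1), of x] sym[of u x] by (simp add: \<theta>_def)
      then show ?thesis using sq[of w v] sq[of x u] sq[OF uv] that by (simp add: X_def Y_def)
    qed
    moreover have "\<theta> w * sig w x * \<theta> x = 1" if "E w x" for w x
    proof -
      have "?A w x = sig w x" using that by (simp add: adj_def)
      moreover have "\<theta> w * ?A w x * \<theta> x = \<theta> x * ?A x w * \<theta> w" using sym[of w x] by simp
      ultimately show ?thesis using *[of w x] *[of x w] EXY[of w x] that by metis
    qed
    ultimately show ?thesis unfolding switching_equiv_all_positive_def by (intro exI[of _ \<theta>]) blast
  qed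
  ultimately show ?thesis by blast
qed

text \<open>Switching to all positive means \<open>sig u v = \<theta> u * \<theta> v\<close> on
  edges. So rows within one part agree up to sign, and one row from each part spans.\<close>

lemma complete_bipartite_adj_rank_le:
  assumes sg: "signed_graph V E sig" and cb: "complete_bipartite V E"
    and sw: "switching_equiv_all_positive V E sig"
  shows "adj_rank V E sig \<le> 2"
proof -
  obtain X Y where XY: "X \<noteq> {}" "Y \<noteq> {}" "X \<inter> Y = {}" "X \<union> Y = V"
    and E: "\<And>u v. E u v \<longleftrightarrow> (u \<in> X \<and> v \<in> Y) \<or> (u \<in> Y \<and> v \<in> X)"
    using cb unfolding complete_bipartite_def by blast
  obtain \<theta> :: "'a \<Rightarrow> real" where \<theta>: "\<And>v. v \<in> V \<Longrightarrow> \<theta> v = 1 \<or> \<theta> v = - 1"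
    and pos: "\<And>u v. E u v \<Longrightarrow> \<theta> u * sig u v * \<theta> v = 1"
    using sw unfolding switching_equiv_all_positive_def by blast
  have sig: "sig u v = \<theta> u * \<theta> v" if "E u v" for u v
    using pos[OF that] \<theta>[of u] \<theta>[of v] signed_graph_adj(1,2)[OF sg that] by fastforce
  have same: "adj E sig w x = \<theta> w * \<theta> u * adj E sig u x"
    if "w \<in> X \<and> u \<in> X \<or> w \<in> Y \<and> u \<in> Y" for w u x
    using that E[of w x] E[of u x] sig[of w x] sig[of u x] \<theta>[of u] XY by (auto simp: adj_def)
  obtain u v where uv: "u \<in> X" "v \<in> Y" using XY by blast
  have neq: "u \<noteq> v" using uv XY by blast
  have "\<exists>c. \<forall>x. adj E sig w x = (\<Sum>t\<in>{u, v}. c t * adj E sig t x)" if "w \<in> V" for w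
  proof (cases "w \<in> X")
    case True
    then show ?thesis
      using neq same[of w u] uv by (intro exI[of _ "\<lambda>t. if t = u then \<theta> w * \<theta> u else 0"]) auto
  next
    case False
    then have "w \<in> Y" using that XY by blast
    then show ?thesis
      using neq same[of w v] uv by (intro exI[of _ "\<lambda>t. if t = v then \<theta> w * \<theta> v else 0"]) auto
  qed
  then have "adj_rank V E sig \<le> card {u, v}" by (intro adj_rank_le) auto
  then show ?thesis using neq by simp
qed

text \<open>A bipartite graph has no triangle. With rank at most two, the general bound then leaves
  only girth four.\<close>

lemma complete_bipartite_girth_neq_3:
  assumes hc: "has_cycle E" and cb: "complete_bipartite V E"
  shows "girth E \<noteq> 3"
proof
  assume "girth E = 3"
  then obtain cs where cs: "is_cycle E cs" "length cs = 3" using girth_cycle[OF hc] by metis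
  then obtain a b c where "cs = [a, b, c]" by (auto simp: length_Suc_conv numeral_3_eq_3)
  then have "E a b" "E b c" "E c a" using cs by (auto simp: is_cycle_iff)
  moreover obtain X Y where "X \<inter> Y = {}"
    "\<And>u v. E u v \<longleftrightarrow> (u \<in> X \<and> v \<in> Y) \<or> (u \<in> Y \<and> v \<in> X)"
    using cb unfolding complete_bipartite_def by blast
  ultimately show False by blast
qed

subsection \<open>Signed cycles\<close>

text \<open>With all vertices on the cycle, any further edge would be a chord.\<close>

lemma shortest_cycle_spanning:
  assumes sg: "signed_graph V E sig" and c: "is_cycle E cs" and len: "length cs = girth E"
    and V: "set cs = V"
  shows "graph_is_cycle V E cs"
proof -
  let ?g = "length cs"
  have g: "?g \<ge> 3" using c by (simp add: is_cycle_def)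
  have *: "\<exists>k < ?g. (u = cs ! k \<and> v = cs ! ((k + 1) mod ?g)) \<or> (v = cs ! k \<and> u = cs ! ((k + 1) mod ?g))"
    if uv: "u = cs ! i" "v = cs ! j" "i < j" "j < ?g" "E u v" for u v i j
  proof -
    from shortest_cycle_chordless[OF sg c len] uv have "j = Suc i \<or> i = 0 \<and> j = ?g - 1" by blast
    then show ?thesis
    proof
      assume "j = Suc i"
      then show ?thesis using uv by (intro exI[of _ i]) auto
    next
      assume "i = 0 \<and> j = ?g - 1"
      then have "i = 0" "Suc j = ?g" using uv by auto
      then show ?thesis using uv by (intro exI[of _ j]) simp
    qed
  qed
  have "\<exists>i < ?g. (u = cs ! i \<and> v = cs ! ((i + 1) mod ?g)) \<or> (v = cs ! i \<and> u = cs ! ((i + 1) mod ?g))"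
    if E: "E u v" for u v
  proof -
    have "u \<in> set cs" "v \<in> set cs" using signed_graph_adj(1,2)[OF sg E] V by auto
    then obtain i j where ij: "i < ?g" "u = cs ! i" "j < ?g" "v = cs ! j"
      by (auto simp: in_set_conv_nth)
    moreover have "i \<noteq> j" using ij signed_graph_adj(4)[OF sg E] by auto
    ultimately show ?thesis
      using *[of u i v j] *[of v j u i] E signed_graph_adj(3)[OF sg E] by (meson nat_neq_iff)
  qed
  moreover have "E u v"
    if "\<exists>i < ?g. (u = cs ! i \<and> v = cs ! ((i + 1) mod ?g)) \<or> (v = cs ! i \<and> u = cs ! ((i + 1) mod ?g))"
    for u v
    using that c signed_graph_adj(3)[OF sg] unfolding is_cycle_def by blast
  ultimately show ?thesis unfolding graph_is_cycle_def using c V by blast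
qed

locale signed_cycle =
  fixes V :: "'a set" and E :: "'a \<Rightarrow> 'a \<Rightarrow> bool" and sig :: "'a \<Rightarrow> 'a \<Rightarrow> real" and cs :: "'a list"
  assumes sg: "signed_graph V E sig" and gc: "graph_is_cycle V E cs"
begin

definition "g = length cs"

text \<open>Indices run over all naturals with period \<open>g\<close>, so that recurrences can be
  followed around the cycle without treating the closing edge separately.\<close>

definition "C j = cs ! (j mod g)"

definition "s j = sig (C j) (C (Suc j))"

lemma g3: "g \<ge> 3" and cyc: "is_cycle E cs" and setcs: "set cs = V" and dist: "distinct cs"
  using gc by (auto simp: graph_is_cycle_def is_cycle_def g_def)

lemma C_eq_iff: "C i = C j \<longleftrightarrow> i mod g = j mod g"
proof -
  have "i mod g < length cs" "j mod g < length cs" using g3 by (auto simp: g_def[symmetric])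
  then show ?thesis unfolding C_def using dist nth_eq_iff_index_eq by blast
qed

lemma C_add_g [simp]: "C (j + g) = C j" "C (Suc (j + g)) = C (Suc j)"
  using C_eq_iff by (auto simp: mod_add_self2 simp flip: add_Suc)

lemma s_add_g [simp]: "s (j + g) = s j"
  by (simp add: s_def)

lemma C_in: "C j \<in> V"
proof -
  have "j mod g < length cs" using g3 by (auto simp: g_def[symmetric])
  then show ?thesis unfolding C_def using setcs nth_mem by blast
qed

text \<open>Written with a successor so that both neighbours, \<open>C j\<close> and
  \<open>C (j + 2)\<close>, have natural indices.\<close>

lemma ex_C_Suc: "x \<in> V \<Longrightarrow> \<exists>j. x = C (Suc j)"
proof -
  assume "x \<in> V"
  then obtain i where i: "i < g" "x = cs ! i" using setcs by (auto simp: in_set_conv_nth g_def)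
  then have "x = C (i + g)" by (simp add: C_def)
  moreover have "i + g = Suc (i + g - 1)" using g3 by simp
  ultimately show ?thesis by metis
qed

lemma C_neq: "C j \<noteq> C (j + 2)"
proof -
  have "\<not> g dvd (j + 2) - j" using g3 dvd_imp_le[of g 2] by auto
  then show ?thesis
    unfolding C_eq_iff using mod_eq_dvd_iff_nat[of j "j + 2" g] by auto
qed

lemma C_cong_Suc: "C i = C j \<Longrightarrow> C (Suc i) = C (Suc j)"
  unfolding C_eq_iff by (metis mod_Suc_eq)

lemma C_Suc_cong: "C (Suc i) = C (Suc j) \<Longrightarrow> C i = C j"
proof -
  assume "C (Suc i) = C (Suc j)"
  then have "(Suc i + (g - 1)) mod g = (Suc j + (g - 1)) mod g"
    unfolding C_eq_iff by (metis mod_add_left_eq)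
  then show ?thesis unfolding C_eq_iff using g3 by simp
qed

lemma E_iff: "E u v \<longleftrightarrow> (\<exists>i. u = C i \<and> v = C (Suc i) \<or> v = C i \<and> u = C (Suc i))"
proof -
  have *: "cs ! i = C i" "cs ! ((i + 1) mod length cs) = C (Suc i)" if "i < g" for i
    using that by (simp_all add: C_def g_def)
  have red: "C (Suc (i mod g)) = C (Suc i)" "C (i mod g) = C i" for i
    unfolding C_eq_iff by (simp_all add: mod_Suc_eq)
  have "E u v \<longleftrightarrow> (\<exists>i<g. u = C i \<and> v = C (Suc i) \<or> v = C i \<and> u = C (Suc i))"
    using gc * unfolding graph_is_cycle_def g_def by (smt (verit))
  moreover have "(\<exists>i. u = C i \<and> v = C (Suc i) \<or> v = C i \<and> u = C (Suc i)) \<Longrightarrow>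
      (\<exists>i<g. u = C i \<and> v = C (Suc i) \<or> v = C i \<and> u = C (Suc i))"
  proof (elim exE)
    fix i assume "u = C i \<and> v = C (Suc i) \<or> v = C i \<and> u = C (Suc i)"
    then show ?thesis using g3 red[of i] by (intro exI[of _ "i mod g"]) auto
  qed
  ultimately show ?thesis by blast
qed

lemma neighbours: "E t (C (Suc j)) \<longleftrightarrow> t = C j \<or> t = C (j + 2)"
proof
  assume "E t (C (Suc j))"
  then obtain i where "t = C i \<and> C (Suc j) = C (Suc i) \<or> C (Suc j) = C i \<and> t = C (Suc i)"
    unfolding E_iff by blast
  then show "t = C j \<or> t = C (j + 2)"
    using C_Suc_cong[of j i] C_cong_Suc[of "Suc j" i] by auto
next
  assume "t = C j \<or> t = C (j + 2)"
  then show "E t (C (Suc j))"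
    unfolding E_iff by auto
qed

lemma s_sq: "s j * s j = 1" and s_nz: "s j \<noteq> 0"
proof -
  have "E (C j) (C (Suc j))" using neighbours[of "C j" j] by simp
  then show "s j * s j = 1" "s j \<noteq> 0" unfolding s_def using signed_graph_adj(6,7)[OF sg] by blast+
qed

text \<open>Exactly two distinct vertices are adjacent to \<open>C (Suc j)\<close>. A linear
  relation between the rows is therefore a two-step recurrence along the cycle.\<close>

lemma adj_sum:
  "(\<Sum>t\<in>V. c t * adj E sig t (C (Suc j))) = c (C j) * s j + c (C (j + 2)) * s (Suc j)"
proof -
  have fin: "finite V" using sg by (simp add: signed_graph_def)
  have E2: "E (C (j + 2)) (C (Suc j))" "E (C j) (C (Suc j))" using neighbours by blast+
  have "(\<Sum>t\<in>V. c t * adj E sig t (C (Suc j))) = (\<Sum>t\<in>{C j, C (j + 2)}. c t * sig t (C (Suc j)))"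
    by (rule sum.mono_neutral_cong_right)
      (use fin C_in neighbours in \<open>auto simp: adj_def\<close>)
  then show ?thesis
    using C_neq[of j] signed_graph_adj(5)[OF sg E2(1)] by (simp add: s_def)
qed

lemma cycle_sign_eq: "cycle_sign sig cs = (\<Prod>t<g. s t)"
proof -
  have "cycle_sign sig cs = (\<Prod>t\<in>set [0..<g]. sig (cs ! t) (cs ! ((t + 1) mod g)))"
    unfolding cycle_sign_def g_def by (subst prod.distinct_set_conv_list) auto
  also have "\<dots> = (\<Prod>t<g. s t)"
    by (rule prod.cong) (auto simp: s_def C_def atLeast0LessThan)
  finally show ?thesis .
qed

text \<open>Moving the start by one trades the factor \<open>s j\<close> for
  \<open>s (j + g)\<close>, which is equal and nonzero.\<close>

lemma prod_s_shift: "(\<Prod>t<g. s (j + t)) = (\<Prod>t<g. s t)"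
proof (induction j)
  case (Suc j)
  have "s j * (\<Prod>t<g. s (Suc j + t)) = (\<Prod>t<Suc g. s (j + t))"
    by (subst prod.lessThan_Suc_shift) simp
  also have "\<dots> = s j * (\<Prod>t<g. s (j + t))" by simp
  finally show ?case using Suc s_nz[of j] by simp
qed simp

text \<open>As \<open>g\<close> is even, \<open>g div 2\<close> double steps of the recurrence lead
  from \<open>t\<close> back to \<open>t\<close>. They multiply \<open>c t\<close> by
  \<open>(- 1) ^ (g div 2)\<close> times the product of all signs, so this factor is
  \<open>1\<close>.\<close>

lemma cycle_sign_if_kernel:
  assumes even: "even g" and ker: "\<And>x. (\<Sum>t\<in>V. c t * adj E sig t x) = 0"
    and t: "t \<in> V" "c t \<noteq> 0"
  shows "cycle_sign sig cs = (- 1) ^ (g div 2)"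
proof -
  have rec: "c (C (j + 2)) = - (s j * s (Suc j)) * c (C j)" for j
  proof -
    have "c (C j) * s j = - (c (C (j + 2)) * s (Suc j))"
      using ker[of "C (Suc j)"] adj_sum[of c j] by simp
    then have "s (Suc j) * (c (C j) * s j) = - (c (C (j + 2)) * (s (Suc j) * s (Suc j)))"
      by (simp add: algebra_simps)
    then show ?thesis by (simp add: s_sq algebra_simps)
  qed
  have iter: "c (C (j + 2 * m)) = (- 1) ^ m * (\<Prod>t<2 * m. s (j + t)) * c (C j)" for j m
  proof (induction m)
    case (Suc m)
    then show ?case using rec[of "j + 2 * m"] by (simp add: algebra_simps)
  qed simp
  obtain j where j: "t = C (Suc j)" using ex_C_Suc[OF t(1)] by blast
  have g: "2 * (g div 2) = g" using even by simp
  have "c t = (- 1) ^ (g div 2) * (\<Prod>t<g. s (Suc j + t)) * c t"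
    using iter[of "Suc j" "g div 2"] by (simp only: g C_add_g j add_Suc)
  then have "(- 1) ^ (g div 2) * cycle_sign sig cs = 1"
    using t(2) unfolding prod_s_shift cycle_sign_eq by simp
  then show ?thesis by (cases "even (g div 2)") auto
qed

text \<open>The recurrence never mixes parities, so under the sign condition each parity class
  carries its own kernel vector. The values at \<open>C 0\<close> and \<open>C 1\<close> separate
  the two.\<close>

lemma kernel_vector:
  assumes even: "even g" and sign: "cycle_sign sig cs = (- 1) ^ (g div 2)" and p: "p < 2"
  obtains d where "\<And>x. (\<Sum>t\<in>V. d t * adj E sig t x) = 0" "d (C p) \<noteq> 0" "d (C (1 - p)) = 0"
proof -
  \<comment> \<open>The explicit solution of the recurrence with \<open>e 0 = 1\<close> and
    \<open>e 1 = s 0\<close>; the sign condition is what gives it period \<open>g\<close>.\<close>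
  define e where "e j = (- 1) ^ (j div 2) * (\<Prod>t<j. s t)" for j
  have e_rec: "e (j + 2) * s (Suc j) = - (e j * s j)" for j
    using s_sq[of "Suc j"] by (simp add: e_def)
  have prod_add: "(\<Prod>t<j + g. s t) = (\<Prod>t<g. s t) * (\<Prod>t<j. s t)" for j
    by (induction j) (simp_all add: mult.assoc)
  have e_period: "e (j + g) = e j" for j
  proof -
    have "(j + g) div 2 = j div 2 + g div 2" using even by (elim evenE) simp
    then have "e (j + g) = (- 1) ^ (j div 2) * (\<Prod>t<j. s t) * ((- 1) ^ (g div 2) * (- 1) ^ (g div 2))"
      using sign by (simp add: e_def prod_add power_add cycle_sign_eq mult.assoc mult.left_commute)
    then show ?thesis by (simp add: e_def power_mult_distrib[symmetric])
  qed
  \<comment> \<open>Keeps one parity class. Since \<open>g\<close> is even, parity survives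
    reduction modulo \<open>g\<close>, so \<open>F\<close> is well defined on the vertices.\<close>
  define F where "F j = (if j mod 2 = p then e j else 0)" for j
  have F_period: "F (j + g) = F j" for j
  proof -
    have "(j + g) mod 2 = j mod 2" using even by (elim evenE) simp
    then show ?thesis by (simp add: F_def e_period)
  qed
  have F_period': "F (j + k * g) = F j" for j k
  proof (induction k)
    case (Suc k)
    have "j + Suc k * g = (j + k * g) + g" by simp
    then show ?case using F_period Suc by metis
  qed simp
  have F_mod: "F (j mod g) = F j" for j
    using F_period'[of "j mod g" "j div g"] by simp
  define d where "d t = F (inv_into {..<g} ((!) cs) t)" for t
  have inj: "inj_on ((!) cs) {..<g}" using dist by (simp add: inj_on_nth g_def)
  have d: "d (C j) = F j" for j
    using inv_into_f_f[OF inj, of "j mod g"] g3 by (simp add: d_def C_def F_mod)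
  have ker: "(\<Sum>t\<in>V. d t * adj E sig t x) = 0" for x
  proof (cases "x \<in> V")
    case True
    then obtain j where j: "x = C (Suc j)" using ex_C_Suc by blast
    have "(j + 2) mod 2 = j mod 2" by simp
    then have "F (j + 2) * s (Suc j) = - (F j * s j)" using e_rec[of j] by (simp add: F_def)
    then show ?thesis unfolding j adj_sum d by simp
  next
    case False
    then have "adj E sig t x = 0" for t using signed_graph_adj(2)[OF sg] by (auto simp: adj_def)
    then show ?thesis by simp
  qed
  have "e p \<noteq> 0" using s_nz by (simp add: e_def)
  then have "d (C p) \<noteq> 0" using p by (simp add: d F_def)
  moreover have "d (C (1 - p)) = 0" using p by (auto simp: d F_def less_2_cases_iff)
  ultimately show ?thesis using that ker by blast
qed

text \<open>The kernel vector for \<open>p\<close> vanishes at the other one of \<open>C 0\<close>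
  and \<open>C 1\<close>, so it expresses the row of \<open>C p\<close> by the rows of the remaining
  \<open>g - 2\<close> vertices.\<close>

lemma adj_rank_le_if_cycle_sign:
  assumes even: "even g" and sign: "cycle_sign sig cs = (- 1) ^ (g div 2)"
  shows "adj_rank V E sig + 2 \<le> g"
proof -
  let ?A = "adj E sig"
  define T where "T = V - {C 0, C 1}"
  have fin: "finite V" using sg by (simp add: signed_graph_def)
  have neq: "C 0 \<noteq> C 1" using g3 by (auto simp: C_eq_iff)
  have card: "card T + 2 = g"
  proof -
    have "card {C 0, C 1} = 2" using neq by simp
    moreover have "card V = g" using distinct_card[OF dist] setcs by (simp add: g_def)
    ultimately show ?thesis
      using card_Diff_subset[of "{C 0, C 1}" V] C_in fin g3 by (simp add: T_def)
  qed
  have special: "\<exists>c. \<forall>x. ?A (C p) x = (\<Sum>t\<in>T. c t * ?A t x)" if p: "p < 2" for p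
  proof -
    obtain d where d: "\<And>x. (\<Sum>t\<in>V. d t * ?A t x) = 0" "d (C p) \<noteq> 0" "d (C (1 - p)) = 0"
      using kernel_vector[OF even sign p] by blast
    have "?A (C p) x = (\<Sum>t\<in>T. (- d t / d (C p)) * ?A t x)" for x
    proof -
      have ins: "V = insert (C p) (insert (C (1 - p)) T)"
        using p C_in by (auto simp: T_def less_2_cases_iff)
      have notin: "C p \<notin> insert (C (1 - p)) T" "C (1 - p) \<notin> T" "finite T"
        using p neq fin by (auto simp: T_def less_2_cases_iff)
      have "d (C p) * ?A (C p) x + (\<Sum>t\<in>T. d t * ?A t x) = 0"
        using d(1)[of x] d(3) notin by (subst (asm) ins) simp
      then have "?A (C p) x = - (\<Sum>t\<in>T. d t * ?A t x) / d (C p)"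
        using d(2) by (simp add: field_simps eq_neg_iff_add_eq_0)
      then show ?thesis by (simp add: sum_divide_distrib sum_negf)
    qed
    then show ?thesis by (intro exI[of _ "\<lambda>t. - d t / d (C p)"]) blast
  qed
  have "\<exists>c. \<forall>x. ?A w x = (\<Sum>t\<in>T. c t * ?A t x)" if "w \<in> V" for w
  proof (cases "w \<in> T")
    case True
    have "(\<Sum>t\<in>T. (if t = w then 1 else 0) * ?A t x) = ?A w x" for x
      using True fin by (simp add: T_def if_distrib[of "\<lambda>y. y * _"] cong: if_cong)
    then show ?thesis by (intro exI[of _ "\<lambda>t. if t = w then 1 else 0"]) simp
  next
    case False
    then have "w = C 0 \<or> w = C 1" using that by (auto simp: T_def)
    then show ?thesis using special[of 0] special[of 1] by auto
  qed
  then have "adj_rank V E sig \<le> card T" using adj_rank_le[of T V E sig] fin by (auto simp: T_def)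
  then show ?thesis using card by simp
qed

text \<open>Lets an unbalanced cycle be read as one of sign \<open>- 1\<close>.\<close>

lemma cycle_sign_cases: "cycle_sign sig cs = 1 \<or> cycle_sign sig cs = - 1"
proof -
  have "(\<Prod>t<g. s t) * (\<Prod>t<g. s t) = 1" by (simp add: prod.distrib[symmetric] s_sq)
  then show ?thesis by (simp add: cycle_sign_eq square_eq_1_iff)
qed

text \<open>A shortest cycle missing some vertex would have a vertex with a third neighbour outside
  it, but here every vertex has only two. So it uses all of \<open>V\<close> and has length
  \<open>g\<close>.\<close>

lemma girth_eq:
  assumes conn: "connected_graph V E"
  shows "girth E = g"
proof -
  have hc: "has_cycle E" using cyc by (auto simp: has_cycle_def)
  obtain ds where ds: "is_cycle E ds" "length ds = girth E" using girth_cycle[OF hc] .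
  have sub: "set ds \<subseteq> V" by (rule cycle_subset[OF sg ds(1)])
  have "set ds = V"
  proof (rule ccontr)
    assume neq: "set ds \<noteq> V"
    have "set ds \<noteq> {}" using ds by (auto simp: is_cycle_def)
    from connected_boundary_edge[OF sg conn sub this neq]
    obtain w x where w: "w \<notin> set ds" "x \<in> set ds" "E w x" by blast
    obtain es where es: "is_cycle E (x # es)" "set (x # es) = set ds"
      using is_cycle_from[OF ds(1) w(2)] by blast
    then have "length es \<ge> 2" by (simp add: is_cycle_def)
    then obtain a as where as: "es = a # as" "as \<noteq> []"
      by (cases es) force+
    have "E x a" "E (last as) x" "a \<notin> set as" using es(1) as by (simp_all add: is_cycle_iff)
    moreover have "a \<in> set ds" "last as \<in> set ds" "last as \<in> set as"
      unfolding es(2)[symmetric] using as by auto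
    moreover have "E a x" using \<open>E x a\<close> signed_graph_adj(3)[OF sg] by blast
    moreover obtain j where "x = C (Suc j)" using ex_C_Suc w(2) sub by blast
    ultimately show False using neighbours w by metis
  qed
  then have "length ds = length cs"
    using ds(1) dist setcs by (metis distinct_card is_cycle_def)
  then show ?thesis using ds by (simp add: g_def)
qed

end

section \<open>The bound and the equality case\<close>

lemma even_mod_4: "even (n :: nat) \<longleftrightarrow> n mod 4 = 0 \<or> n mod 4 = 2"
  by presburger

lemma minus_one_power_half:
  fixes n :: nat
  shows "n mod 4 = 0 \<Longrightarrow> (- 1) ^ (n div 2) = (1 :: 'b :: ring_1)"
    and "n mod 4 = 2 \<Longrightarrow> (- 1) ^ (n div 2) = (- 1 :: 'b)"
proof -
  have "n mod 4 = 0 \<Longrightarrow> even (n div 2)" "n mod 4 = 2 \<Longrightarrow> odd (n div 2)" by presburger+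
  then show "n mod 4 = 0 \<Longrightarrow> (- 1) ^ (n div 2) = (1 :: 'b)"
    and "n mod 4 = 2 \<Longrightarrow> (- 1) ^ (n div 2) = (- 1 :: 'b)" by simp_all
qed

theorem theorem5p1:
  fixes V :: "'a set" and E :: "'a \<Rightarrow> 'a \<Rightarrow> bool" and sig :: "'a \<Rightarrow> 'a \<Rightarrow> real"
  assumes "signed_graph V E sig" and "connected_graph V E" and "has_cycle E"
  shows "int (nullity V E sig) \<le> int (card V) - int (girth E) + 2
    \<and> (int (nullity V E sig) = int (card V) - int (girth E) + 2 \<longleftrightarrow>
         (\<exists>cs. graph_is_cycle V E cs \<and> balanced_cycle sig cs \<and> girth E mod 4 = 0)
       \<or> (\<exists>cs. graph_is_cycle V E cs \<and> \<not> balanced_cycle sig cs \<and> girth E mod 4 = 2)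
       \<or> (complete_bipartite V E \<and> switching_equiv_all_positive V E sig))"
proof -
  note sg = assms(1) and conn = assms(2) and hc = assms(3)
  let ?r = "adj_rank V E sig" and ?g = "girth E"
  let ?C1 = "\<exists>cs. graph_is_cycle V E cs \<and> balanced_cycle sig cs \<and> ?g mod 4 = 0"
  let ?C2 = "\<exists>cs. graph_is_cycle V E cs \<and> \<not> balanced_cycle sig cs \<and> ?g mod 4 = 2"
  let ?C3 = "complete_bipartite V E \<and> switching_equiv_all_positive V E sig"
  have fin: "finite V" using sg by (simp add: signed_graph_def)
  have nul: "nullity V E sig + ?r = card V" by (rule nullity_add_adj_rank[OF sg])
  have bound: "?g \<le> ?r + 2" by (rule girth_le_adj_rank(1)[OF sg hc])
  have eq_iff: "int (nullity V E sig) = int (card V) - int ?g + 2 \<longleftrightarrow> ?g = ?r + 2"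
    using nul by linarith
  obtain cs where cs: "is_cycle E cs" "length cs = ?g" using girth_cycle[OF hc] .
  have g3: "?g \<ge> 3" using cs by (simp add: is_cycle_def)
  have sub: "set cs \<subseteq> V" by (rule cycle_subset[OF sg cs(1)])
  have "?C1 \<or> ?C2 \<or> ?C3" if eq: "?g = ?r + 2"
  proof -
    have even: "even ?g" using girth_le_adj_rank(2)[OF sg hc] eq by auto
    then consider "?g = 4" | "?g > 4" using g3 by (cases "?g = 3") force+
    then show ?thesis
    proof cases
      case 1
      have "E (cs ! 0) (cs ! 1)" using cs g3 by (simp add: is_cycle_iff successively_conv_nth)
      then show ?thesis using adj_rank_2_complete_bipartite[OF sg conn] eq 1 by simp
    next
      case 2
      have V: "set cs = V"
      proof (rule ccontr)
        assume neq: "set cs \<noteq> V"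
        have "set cs \<noteq> {}" using cs g3 by auto
        from connected_boundary_edge[OF sg conn sub this neq]
        obtain w x where w: "w \<in> V" "w \<notin> set cs" "x \<in> set cs" "E w x" by blast
        obtain ds where ds: "is_cycle E (x # ds)" "set (x # ds) = set cs" "length (x # ds) = length cs"
          using is_cycle_from[OF cs(1) w(3)] by blast
        \<comment> \<open>The outside vertex \<open>w\<close> followed by all but one vertex of the
          cycle, started at its neighbour \<open>x\<close>: an even number \<open>?g\<close> of
          vertices, against rank \<open>?g - 2\<close>.\<close>
        let ?ps = "w # take (?g - 1) (x # ds)"
        have "w \<notin> set (x # ds)" using w(2) by (simp only: ds(2) not_False_eq_True)
        then have "induced_path E ?ps"
          using induced_path_Cons_take[OF sg ds(1) _ _ _ w(4), of "?g - 1"] ds(3) cs(2) 2 by linarith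
        moreover have len: "length ?ps = ?g" using ds cs 2 by simp
        moreover have "set ?ps \<subseteq> V"
          using w(1) sub ds(2) in_set_takeD[of _ "?g - 1" "x # ds"] by auto
        ultimately have "?g \<le> ?r"
          using induced_path_even_length_le_adj_rank[OF sg, of ?ps] even by metis
        then show False using eq by simp
      qed
      then have gc: "graph_is_cycle V E cs" by (rule shortest_cycle_spanning[OF sg cs])
      interpret signed_cycle V E sig cs using sg gc by unfold_locales
      have g: "g = ?g" using cs by (simp add: g_def)
      have "card V = ?g" using V cs distinct_card[of cs] by (auto simp: is_cycle_def)
      \<comment> \<open>There are more rows than the rank, so they are dependent; the coefficients
        of a dependence form the kernel vector that determines the sign.\<close>
      then have "\<not> card V \<le> ?r" using eq by simp
      then obtain c t where "\<And>x. (\<Sum>t\<in>V. c t * adj E sig t x) = 0" "t \<in> V" "c t \<noteq> 0"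
        using adj_rank_ge(1)[OF fin subset_refl, of E sig] by blast
      then have sign: "cycle_sign sig cs = (- 1) ^ (?g div 2)"
        using cycle_sign_if_kernel even g by metis
      have "?g mod 4 = 0 \<or> ?g mod 4 = 2" using even even_mod_4 by blast
      then show ?thesis
        using gc sign minus_one_power_half[of ?g, where 'b = real]
        by (auto simp: balanced_cycle_def)
    qed
  qed
  moreover have "?g = ?r + 2" if RHS: "?C1 \<or> ?C2 \<or> ?C3"
  proof (cases ?C3)
    case True
    then have "?r \<le> 2" "?g \<noteq> 3"
      using complete_bipartite_adj_rank_le[OF sg] complete_bipartite_girth_neq_3[OF hc] by auto
    then show ?thesis using bound g3 by simp
  next
    case False
    then have "?C1 \<or> ?C2" using RHS by argo
    then have "\<exists>ds. graph_is_cycle V E ds \<and>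
        (balanced_cycle sig ds \<and> ?g mod 4 = 0 \<or> \<not> balanced_cycle sig ds \<and> ?g mod 4 = 2)"
      by (elim disjE exE) auto
    then obtain ds where gc: "graph_is_cycle V E ds"
      and bal: "balanced_cycle sig ds \<and> ?g mod 4 = 0 \<or> \<not> balanced_cycle sig ds \<and> ?g mod 4 = 2"
      by (elim exE conjE)
    interpret signed_cycle V E sig ds using sg gc by unfold_locales
    \<comment> \<open>The given spanning cycle \<open>ds\<close> is not assumed to be shortest,
      while the congruence concerns the girth.\<close>
    have g: "g = ?g" using girth_eq[OF conn] by simp
    have even: "even ?g" unfolding even_mod_4 using bal by argo
    have "cycle_sign sig ds = (- 1) ^ (?g div 2)"
      using bal cycle_sign_cases minus_one_power_half[of ?g, where 'b = real]
      by (auto simp: balanced_cycle_def)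
    then have "?r + 2 \<le> ?g" using adj_rank_le_if_cycle_sign even g by simp
    then show ?thesis using bound by simp
  qed
  ultimately have "?g = ?r + 2 \<longleftrightarrow> ?C1 \<or> ?C2 \<or> ?C3" by (rule iffI)
  moreover have "int (nullity V E sig) \<le> int (card V) - int ?g + 2" using nul bound by linarith
  ultimately show ?thesis unfolding eq_iff by (intro conjI)
qed

end
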